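(* For every constant $\gamma>0$ there is a constant $c>0$ such that the following holds. Let $w$ and $N$ be integers with $0 < w < 2w \le N$ and $N \ge 2^{\gamma w}$. Let $R_x = [2w,N] \times [0,w]$, $R_y = [0,w] \times [2w,N]$, and $L = R_x \cup R_y$. Let $p(x,y)$ be a real bivariate polynomial of degree $d$ such that (1) $p(2w,2w) \ge 2$, and (2) $0 \le p(x,y) \le 1$ for all $(x,y) \in L \cap \mathbb{Z}^2$. Then $d \ge c\, w$, i.e. $d=\Omega(w)$.
   Context: The degree of a bivariate polynomial is its total degree. The hypothesis "$N = 2^{\Omega(w)}$" is interpreted as $N\ge 2^{\gamma w}$ for a fixed constant $\gamma>0$. *)

theory Defs
  imports Complex_Main "HOL-Computational_Algebra.Polynomial"
begin

(* A real bivariate polynomial is an element of R[y][x]: the coefficient of the monomial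
   x^i * y^j is coeff (coeff p i) j. *)
definition eval2 :: "real poly poly \<Rightarrow> real \<Rightarrow> real \<Rightarrow> real" where
  "eval2 p x y = poly (poly p [:x:]) y"

(* The zero polynomial gets total degree 0, as for the library's degree. *)
definition total_degree :: "real poly poly \<Rightarrow> nat" where
  "total_degree p = Max (insert 0 {i + j | i j. coeff (coeff p i) j \<noteq> 0})"

definition R_x :: "int \<Rightarrow> int \<Rightarrow> (real \<times> real) set" where
  "R_x w N = {2 * of_int w..of_int N} \<times> {0..of_int w}"

definition R_y :: "int \<Rightarrow> int \<Rightarrow> (real \<times> real) set" where
  "R_y w N = {0..of_int w} \<times> {2 * of_int w..of_int N}"

definition L_region :: "int \<Rightarrow> int \<Rightarrow> (real \<times> real) set" where
  "L_region w N = R_x w N \<union> R_y w N"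

lemma eval2_altdef:
  "eval2 p x y = (\<Sum>i\<le>degree p. \<Sum>j\<le>degree (coeff p i). coeff (coeff p i) j * x ^ i * y ^ j)"
proof -
  have "eval2 p x y = (\<Sum>i\<le>degree p. poly (coeff p i) y * x ^ i)"
    unfolding eval2_def by (subst poly_altdef) (simp add: poly_sum poly_power)
  also have "\<dots> = (\<Sum>i\<le>degree p. \<Sum>j\<le>degree (coeff p i). coeff (coeff p i) j * x ^ i * y ^ j)"
    by (simp add: poly_altdef[of "coeff p _"] sum_distrib_left mult_ac)
  finally show ?thesis .
qed

lemma finite_total_degree_set:
  fixes p :: "real poly poly"
  shows "finite {i + j | i j. coeff (coeff p i) j \<noteq> 0}"
proof -
  have "{i + j | i j. coeff (coeff p i) j \<noteq> 0}
      \<subseteq> (\<Union>i\<le>degree p. (\<lambda>j. i + j) ` {..degree (coeff p i)})"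
  proof
    fix n assume "n \<in> {i + j | i j. coeff (coeff p i) j \<noteq> 0}"
    then obtain i j where n: "n = i + j" "coeff (coeff p i) j \<noteq> 0" by auto
    then have "coeff p i \<noteq> 0" by auto
    with n show "n \<in> (\<Union>i\<le>degree p. (\<lambda>j. i + j) ` {..degree (coeff p i)})"
      by (auto intro!: le_degree)
  qed
  then show ?thesis by (rule finite_subset) auto
qed

end

theory Submission imports Defs begin

text \<open>
  For an integer \<open>y \<in> [0, w]\<close> the slice \<open>x \<mapsto> p(x, y)\<close> is bounded on the integers of the exponentially
  long interval \<open>[2w, N]\<close>, so it is nearly constant at the scale \<open>w\<close>: extrapolating its difference
  quotient at \<open>2w\<close> from widely spaced nodes gives \<open>\<bar>p(2w, y) - p(0, y)\<bar> \<le> 2w \<cdot> 30\<^sup>d / M\<close>, where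
  the spacing \<open>M\<close> may exceed \<open>2w \<cdot> 900\<^sup>d\<close> because \<open>N\<close> is exponential in \<open>w\<close>. Extrapolating \<open>y \<mapsto> p(2w, y) - p(0, y)\<close> from
  \<open>[0, w]\<close> to \<open>y = 2w\<close> costs another factor \<open>30\<^sup>d\<close>. If \<open>d < c w\<close> with \<open>c\<close> small compared to \<open>\<gamma>\<close>,
  the result is still less than 1, although \<open>p(2w, 2w) \<ge> 2\<close> and \<open>p(0, 2w) \<le> 1\<close>.
\<close>

section \<open>Lagrange interpolation and extrapolation from equispaced nodes\<close>

lemma lagrange_interpolation:
  fixes q :: "'a::field poly" and x :: "'i \<Rightarrow> 'a"
  assumes "finite I" and inj: "inj_on x I" and deg: "degree q < card I"
  shows "poly q t = (\<Sum>j\<in>I. poly q (x j) * (\<Prod>i\<in>I - {j}. (t - x i) / (x j - x i)))"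
proof -
  define l where "l j = (\<Prod>i\<in>I - {j}. smult (1 / (x j - x i)) [:- x i, 1:])" for j
  define L where "L = (\<Sum>j\<in>I. smult (poly q (x j)) (l j))"
  have poly_l: "poly (l j) s = (\<Prod>i\<in>I - {j}. (s - x i) / (x j - x i))" for j s
    unfolding l_def poly_prod by (intro prod.cong) (auto simp: diff_divide_distrib)
  have l_node: "poly (l j) (x k) = (if j = k then 1 else 0)" if "j \<in> I" "k \<in> I" for j k
  proof (cases "j = k")
    case True
    then show ?thesis
      unfolding poly_l using that by (auto intro!: prod.neutral simp: inj_on_eq_iff[OF inj] split: if_splits)
  next
    case False
    then show ?thesis
      unfolding poly_l using that \<open>finite I\<close> by auto
  qed
  have "degree (l j) \<le> card I - 1" if "j \<in> I" for j
  proof -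
    have "degree (l j) \<le> (\<Sum>i\<in>I - {j}. degree (smult (1 / (x j - x i)) [:- x i, 1:]))"
      unfolding l_def
      by (rule degree_prod_sum_le[unfolded o_def]) (use \<open>finite I\<close> in auto)
    also have "\<dots> \<le> (\<Sum>i\<in>I - {j}. 1)"
      by (intro sum_mono) auto
    finally show ?thesis
      using that \<open>finite I\<close> by simp
  qed
  then have "degree L \<le> card I - 1"
    unfolding L_def using \<open>finite I\<close>
    by (intro degree_sum_le) (auto intro: order.trans[OF degree_smult_le])
  then have deg_L: "degree L < card I"
    using deg by linarith
  have "poly L (x k) = poly q (x k)" if "k \<in> I" for k
  proof -
    have "poly L (x k) = (\<Sum>j\<in>I. if j = k then poly q (x k) else 0)"
      unfolding L_def poly_sum poly_smult using that by (intro sum.cong) (auto simp: l_node)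
    then show ?thesis
      using that \<open>finite I\<close> by simp
  qed
  then have "q = L"
    using deg deg_L inj by (intro poly_eqI_degree[of "x ` I"]) (auto simp: card_image)
  then have "poly q t = poly L t"
    by simp
  then show ?thesis
    by (simp add: L_def poly_sum poly_l)
qed

text \<open>These are the Lagrange denominators for the nodes 0, ..., n: the factors with
  \<open>i < j\<close> multiply to j!, those with \<open>i > j\<close> to (n - j)!. Their
  reciprocals are binomial coefficients divided by n!.\<close>

lemma prod_abs_diff_nodes:
  assumes "j \<le> n"
  shows "(\<Prod>i\<in>{..n} - {j}. \<bar>real j - real i\<bar>) = fact j * fact (n - j)"
proof -
  have split: "{..n} - {j} = {..<j} \<union> {j<..n}"
    using assms by auto
  have "(\<Prod>i<j. \<bar>real j - real i\<bar>) = (\<Prod>i<j. real (j - i))"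
    by (intro prod.cong) (auto simp: of_nat_diff)
  also have "\<dots> = (\<Prod>i\<in>{1..j}. real i)"
    by (rule prod.reindex_bij_witness[of _ "\<lambda>i. j - i" "\<lambda>i. j - i"]) auto
  also have "\<dots> = fact j"
    by (simp add: fact_prod)
  finally have 1: "(\<Prod>i<j. \<bar>real j - real i\<bar>) = fact j" .
  have "(\<Prod>i\<in>{j<..n}. \<bar>real j - real i\<bar>) = (\<Prod>i\<in>{j<..n}. real (i - j))"
    by (intro prod.cong) (auto simp: of_nat_diff)
  also have "\<dots> = (\<Prod>i\<in>{1..n - j}. real i)"
    by (rule prod.reindex_bij_witness[of _ "\<lambda>i. i + j" "\<lambda>i. i - j"]) auto
  also have "\<dots> = fact (n - j)"
    by (simp add: fact_prod)
  finally have 2: "(\<Prod>i\<in>{j<..n}. \<bar>real j - real i\<bar>) = fact (n - j)" .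
  show ?thesis
    unfolding split by (subst prod.union_disjoint) (simp_all only: 1 2, auto)
qed

text \<open>The quotient n^n / n! is a single term of the exponential series at n, hence at most
  e^n, and e is at most 3.\<close>

lemma power_self_le_fact: "real n ^ n \<le> 3 ^ n * fact n"
proof -
  have "(\<Sum>k\<in>{n}. real n ^ k /\<^sub>R fact k) \<le> exp (real n)"
    unfolding exp_def by (intro sum_le_suminf summable_exp_generic) auto
  also have "exp (real n) = exp 1 ^ n"
    by (simp flip: exp_of_nat_mult)
  also have "\<dots> \<le> 3 ^ n"
    by (intro power_mono exp_le) auto
  finally show ?thesis
    by (simp add: field_simps)
qed

text \<open>Every Lagrange numerator is a product of n factors of size at most (K + 1) n h, and the
  denominators are j! (n - j)! h^n, so the spacing h cancels. Summing the binomial coefficients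
  gives 2^n, and n^n / n! gives 3^n, which explains the base 6 (K + 1).\<close>

lemma poly_bound_equispaced:
  fixes q :: "real poly"
  assumes deg: "degree q \<le> n" and "h > 0" "K \<ge> 0" and t: "\<bar>t - a\<bar> \<le> K * real n * h"
    and bound: "\<And>i. i \<le> n \<Longrightarrow> \<bar>poly q (a + real i * h)\<bar> \<le> B"
  shows "\<bar>poly q t\<bar> \<le> (6 * (K + 1)) ^ n * B"
proof -
  define x where "x i = a + real i * h" for i :: nat
  define C where "C = (K + 1) * real n"
  have B: "B \<ge> 0"
    using bound[of 0] by linarith
  have basis: "\<bar>\<Prod>i\<in>{..n} - {j}. (t - x i) / (x j - x i)\<bar> \<le> C ^ n / fact n * real (n choose j)"
    if "j \<le> n" for j
  proof -
    have "\<bar>\<Prod>i\<in>{..n} - {j}. (t - x i) / (x j - x i)\<bar>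
        = (\<Prod>i\<in>{..n} - {j}. \<bar>(t - x i) / (x j - x i)\<bar>)"
      by (simp only: abs_prod)
    also have "\<dots> \<le> (\<Prod>i\<in>{..n} - {j}. C / \<bar>real j - real i\<bar>)"
    proof (intro prod_mono conjI)
      fix i assume i: "i \<in> {..n} - {j}"
      have "\<bar>t - x i\<bar> \<le> \<bar>t - a\<bar> + real i * h"
        unfolding x_def using \<open>h > 0\<close> by (smt (verit) mult_nonneg_nonneg of_nat_0_le_iff)
      also have "\<dots> \<le> K * real n * h + real n * h"
        using t i \<open>h > 0\<close> by (intro add_mono mult_right_mono) auto
      finally have "\<bar>t - x i\<bar> \<le> C * h"
        by (simp add: C_def algebra_simps)
      moreover have "\<bar>x j - x i\<bar> = \<bar>real j - real i\<bar> * h"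
        using \<open>h > 0\<close> by (simp add: x_def abs_mult flip: left_diff_distrib)
      ultimately have "\<bar>t - x i\<bar> / \<bar>x j - x i\<bar> \<le> C * h / (\<bar>real j - real i\<bar> * h)"
        using \<open>h > 0\<close> by (metis abs_ge_zero divide_right_mono)
      then show "\<bar>(t - x i) / (x j - x i)\<bar> \<le> C / \<bar>real j - real i\<bar>"
        using \<open>h > 0\<close> by simp
    qed auto
    also have "\<dots> = C ^ n / (fact j * fact (n - j))"
      using that by (simp add: prod_dividef prod_abs_diff_nodes)
    also have "\<dots> = C ^ n / fact n * real (n choose j)"
      using that by (simp add: binomial_fact)
    finally show ?thesis .
  qed
  have "poly q t = (\<Sum>j\<le>n. poly q (x j) * (\<Prod>i\<in>{..n} - {j}. (t - x i) / (x j - x i)))"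
    using deg \<open>h > 0\<close> by (intro lagrange_interpolation) (auto simp: x_def inj_on_def)
  then have "\<bar>poly q t\<bar>
      \<le> (\<Sum>j\<le>n. \<bar>poly q (x j) * (\<Prod>i\<in>{..n} - {j}. (t - x i) / (x j - x i))\<bar>)"
    by (simp only: sum_abs)
  also have "\<dots> \<le> (\<Sum>j\<le>n. B * (C ^ n / fact n * real (n choose j)))"
    unfolding abs_mult using bound basis B by (intro sum_mono mult_mono) (auto simp: x_def)
  also have "\<dots> = B * (C ^ n / fact n) * real (\<Sum>j\<le>n. n choose j)"
    by (simp only: sum_distrib_left of_nat_sum mult.assoc)
  also have "\<dots> = B * (2 * (K + 1)) ^ n * (real n ^ n / fact n)"
    unfolding choose_row_sum C_def power_mult_distrib by simp
  also have "\<dots> \<le> B * (2 * (K + 1)) ^ n * 3 ^ n"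
    using B \<open>K \<ge> 0\<close> power_self_le_fact[of n] by (intro mult_left_mono) (auto simp: field_simps)
  also have "\<dots> = (6 * (K + 1)) ^ n * B"
    by (simp flip: power_mult_distrib)
  finally show ?thesis .
qed

section \<open>One-variable slices and their near constancy on long intervals\<close>

lemma total_degree_coeff_le:
  assumes "coeff (coeff p i) j \<noteq> 0"
  shows "i + j \<le> total_degree p"
  unfolding total_degree_def using assms finite_total_degree_set[of p]
  by (intro Max_ge) auto

lemma degree_slice_y: "degree (poly p [:x:]) \<le> total_degree p"
proof -
  have "degree (coeff p i * [:x:] ^ i) \<le> total_degree p" for i
  proof (cases "coeff p i = 0")
    case False
    then have "i + degree (coeff p i) \<le> total_degree p"
      by (intro total_degree_coeff_le) simp
    moreover have "degree (coeff p i * [:x:] ^ i) \<le> degree (coeff p i) + degree ([:x:] ^ i)"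
      by (rule degree_mult_le)
    moreover have "degree ([:x:] ^ i) = 0"
      by (simp add: poly_const_pow)
    ultimately show ?thesis
      by linarith
  qed simp
  then show ?thesis
    unfolding poly_altdef[of p] by (intro degree_sum_le) auto
qed

text \<open>The outer variable is x, so fixing y means evaluating every coefficient at y, whereas
  fixing x, as in \<open>degree_slice_y\<close>, is evaluation at a constant polynomial.\<close>

lemma slice_x_exists:
  obtains r where "degree r \<le> total_degree p" "\<And>x. eval2 p x y = poly r x"
proof
  show "degree (map_poly (\<lambda>q. poly q y) p) \<le> total_degree p"
  proof (cases "p = 0")
    case False
    then have "degree p + degree (lead_coeff p) \<le> total_degree p"
      by (intro total_degree_coeff_le) simp
    then show ?thesis
      by (intro degree_le) (auto simp: coeff_map_poly coeff_eq_0)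
  qed simp
  show "eval2 p x y = poly (map_poly (\<lambda>q. poly q y) p) x" for x
    unfolding eval2_def by (induction p) (simp_all add: map_poly_pCons)
qed

text \<open>Let q be the difference quotient of r at b. At a node b + iM with i >= 1 the values of r
  differ from r(b) by at most 1 over a distance of at least M, so |q| <= 1/M there. Extrapolating q
  to 0 costs 30^n, and multiplying by the distance b returns to r.\<close>

lemma poly_almost_constant:
  fixes r :: "real poly"
  assumes deg: "degree r \<le> n" and "n \<ge> 1" and "0 < b" "b \<le> M"
    and bound: "\<And>i. i \<le> n + 1 \<Longrightarrow> 0 \<le> poly r (b + real i * M) \<and> poly r (b + real i * M) \<le> 1"
  shows "\<bar>poly r b - poly r 0\<bar> \<le> b * (30 ^ n / M)"
proof -
  have "poly (r - [:poly r b:]) b = 0"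
    by simp
  then obtain q where q: "r - [:poly r b:] = [:- b, 1:] * q"
    by (metis poly_eq_0_iff_dvd dvdE)
  have "degree q \<le> degree (r - [:poly r b:])"
    unfolding q by (cases "q = 0") (simp_all add: degree_mult_eq del: mult_pCons_left)
  also have "\<dots> \<le> n"
    using deg by (intro degree_diff_le) auto
  finally have deg_q: "degree q \<le> n" .
  have q_eq: "poly r t - poly r b = (t - b) * poly q t" for t
    using arg_cong[OF q, of "\<lambda>f. poly f t"] by (simp add: algebra_simps)
  \<comment> \<open>The nodes start at b + M, since the bound on q comes from dividing by the
    distance to b. A distance factor of 2 would do here; 4 makes the base 30, the same as in the
    extrapolation in y.\<close>
  have "\<bar>poly q 0\<bar> \<le> (6 * (4 + 1)) ^ n * (1 / M)"
  proof (rule poly_bound_equispaced[OF deg_q, where a = "b + M" and h = M])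
    have "\<bar>0 - (b + M)\<bar> \<le> 4 * 1 * M"
      using \<open>0 < b\<close> \<open>b \<le> M\<close> by simp
    also have "\<dots> \<le> 4 * real n * M"
      using \<open>n \<ge> 1\<close> \<open>0 < b\<close> \<open>b \<le> M\<close> by (intro mult_right_mono mult_left_mono) auto
    finally show "\<bar>0 - (b + M)\<bar> \<le> 4 * real n * M" .
  next
    fix i assume "i \<le> n"
    have node: "b + M + real i * M = b + real (Suc i) * M"
      by (simp add: algebra_simps)
    have "0 \<le> poly r (b + M + real i * M) \<and> poly r (b + M + real i * M) \<le> 1"
      unfolding node using \<open>i \<le> n\<close> by (intro bound) auto
    moreover have "0 \<le> poly r b \<and> poly r b \<le> 1"
      using bound[of 0] by simp
    ultimately have "\<bar>poly r (b + M + real i * M) - poly r b\<bar> \<le> 1"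
      by linarith
    then have "real (Suc i) * M * \<bar>poly q (b + M + real i * M)\<bar> \<le> 1"
      using \<open>0 < b\<close> \<open>b \<le> M\<close> by (simp add: q_eq abs_mult algebra_simps)
    moreover have "1 * M * \<bar>poly q (b + M + real i * M)\<bar>
        \<le> real (Suc i) * M * \<bar>poly q (b + M + real i * M)\<bar>"
      using \<open>0 < b\<close> \<open>b \<le> M\<close> by (intro mult_right_mono) auto
    ultimately have "1 * M * \<bar>poly q (b + M + real i * M)\<bar> \<le> 1"
      by (rule order.trans[rotated])
    then show "\<bar>poly q (b + M + real i * M)\<bar> \<le> 1 / M"
      using \<open>0 < b\<close> \<open>b \<le> M\<close> by (simp add: pos_le_divide_eq mult.commute[of _ M])
  qed (use \<open>0 < b\<close> \<open>b \<le> M\<close> in auto)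
  moreover have "\<bar>poly r b - poly r 0\<bar> = b * \<bar>poly q 0\<bar>"
    using q_eq[of 0] \<open>0 < b\<close> by (simp add: abs_mult flip: abs_minus_commute[of "poly r 0"])
  ultimately show ?thesis
    using mult_left_mono[of "\<bar>poly q 0\<bar>" "30 ^ n / M" b] \<open>0 < b\<close> by simp
qed

section \<open>The bound at the corner (2w, 2w) and the choice of constants\<close>

lemma of_int_mem_L_region:
  assumes "2 * w \<le> x" "x \<le> N" "0 \<le> y" "y \<le> w"
  shows "(real_of_int x, real_of_int y) \<in> L_region w N"
proof -
  have "real_of_int (2 * w) \<le> real_of_int x"
    using assms(1) by (simp only: of_int_le_iff)
  then show ?thesis
    using assms by (simp add: L_region_def R_x_def)
qed

text \<open>The factor 900^n in the condition on M is 30^n for the extrapolation in x times 30^n for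
  the one in y. The condition on N keeps the last node 2w + (n + 1) M inside the strip.\<close>

lemma corner_bound:
  fixes w N M :: int and p :: "real poly poly"
  assumes "0 < w" and deg: "total_degree p \<le> n" and "1 \<le> n" "int n \<le> w"
    and M: "2 * w * 900 ^ n < M" and N: "2 * w + int (n + 1) * M \<le> N"
    and bound: "\<And>x y. (x, y) \<in> L_region w N \<Longrightarrow> x \<in> \<int> \<Longrightarrow> y \<in> \<int> \<Longrightarrow>
      0 \<le> eval2 p x y \<and> eval2 p x y \<le> 1"
  shows "eval2 p (2 * real_of_int w) (2 * real_of_int w) < 2"
proof -
  define b where "b = 2 * real_of_int w"
  define B where "B = b * (30 ^ n / real_of_int M)"
  have "2 * w * 1 \<le> 2 * w * 900 ^ n"
    using \<open>0 < w\<close> by (intro mult_left_mono) auto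
  then have wM: "2 * w \<le> M"
    using M by linarith
  have "b > 0"
    using \<open>0 < w\<close> by (simp add: b_def)
  have variation: "\<bar>eval2 p b (real_of_int y) - eval2 p 0 (real_of_int y)\<bar> \<le> B"
    if y: "0 \<le> y" "y \<le> w" for y :: int
  proof -
    obtain r where r: "degree r \<le> total_degree p"
        "\<And>x. eval2 p x (real_of_int y) = poly r x"
      using slice_x_exists by metis
    have "\<bar>poly r b - poly r 0\<bar> \<le> b * (30 ^ n / real_of_int M)"
    proof (rule poly_almost_constant)
      fix i assume i: "i \<le> n + 1"
      have node: "b + real i * real_of_int M = real_of_int (2 * w + int i * M)"
        by (simp add: b_def)
      have "int i * M \<le> int (n + 1) * M"
        using i wM \<open>0 < w\<close> by (intro mult_right_mono) auto
      then have "2 * w + int i * M \<le> N"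
        using N by linarith
      moreover have "0 \<le> int i * M"
        using wM \<open>0 < w\<close> by simp
      ultimately have "(b + real i * real_of_int M, real_of_int y) \<in> L_region w N"
        unfolding node using y by (intro of_int_mem_L_region) auto
      then show "0 \<le> poly r (b + real i * real_of_int M)
          \<and> poly r (b + real i * real_of_int M) \<le> 1"
        unfolding r(2)[symmetric] using node by (intro bound) auto
    next
      show "b \<le> real_of_int M"
        using wM unfolding b_def by linarith
    qed (use r(1) deg \<open>1 \<le> n\<close> \<open>b > 0\<close> in auto)
    then show ?thesis
      by (simp add: r(2) B_def)
  qed
  define s where "s = poly p [:b:] - poly p [:0:]"
  have s: "poly s y = eval2 p b y - eval2 p 0 y" for y
    by (simp add: s_def eval2_def)
  have deg_s: "degree s \<le> n"
    unfolding s_def using degree_slice_y[of p b] degree_slice_y[of p 0] deg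
    by (intro degree_diff_le) auto
  \<comment> \<open>The spacing in y must be an integer because p is controlled only at integer
    points. The nodes 0, m, ..., nm stay in [0, w], and rounding down loses less than half: w < nm +
    n <= 2nm. Hence 2w <= 4nm, which is the distance factor 4.\<close>
  define m where "m = w div int n"
  have "m \<ge> 1"
    using \<open>1 \<le> n\<close> \<open>int n \<le> w\<close> pos_imp_zdiv_pos_iff[of "int n" w] by (simp add: m_def)
  have nm: "int n * m \<le> w"
    using \<open>1 \<le> n\<close> pos_mod_sign[of "int n" w] mult_div_mod_eq[of "int n" w]
    unfolding m_def by linarith
  have "w < int n * m + int n"
    using \<open>1 \<le> n\<close> pos_mod_bound[of "int n" w] mult_div_mod_eq[of "int n" w]
    unfolding m_def by linarith
  also have "\<dots> \<le> int n * m + int n * m"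
    using \<open>m \<ge> 1\<close> \<open>1 \<le> n\<close> by simp
  finally have w_le: "2 * w \<le> 4 * int n * m"
    by simp
  have "\<bar>poly s b\<bar> \<le> (6 * (4 + 1)) ^ n * B"
  proof (rule poly_bound_equispaced[OF deg_s, where a = 0 and h = "real_of_int m"])
    have "real_of_int (2 * w) \<le> real_of_int (4 * int n * m)"
      using w_le by (simp only: of_int_le_iff)
    then show "\<bar>b - 0\<bar> \<le> 4 * real n * real_of_int m"
      using \<open>0 < w\<close> by (simp add: b_def)
  next
    fix i assume "i \<le> n"
    then have "int i * m \<le> int n * m"
      using \<open>m \<ge> 1\<close> by (intro mult_right_mono) auto
    then have "int i * m \<le> w"
      using nm by linarith
    then have "\<bar>eval2 p b (real_of_int (int i * m)) - eval2 p 0 (real_of_int (int i * m))\<bar> \<le> B"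
      using \<open>m \<ge> 1\<close> by (intro variation) auto
    then show "\<bar>poly s (0 + real i * real_of_int m)\<bar> \<le> B"
      by (simp add: s)
  qed (use \<open>m \<ge> 1\<close> in auto)
  also have "(6 * (4 + 1)) ^ n * B = b * 900 ^ n / real_of_int M"
    by (simp add: B_def flip: power_mult_distrib)
  also have "\<dots> < 1"
  proof -
    have "real_of_int (2 * w * 900 ^ n) < real_of_int M"
      using M by (simp only: of_int_less_iff)
    then show ?thesis
      using wM \<open>0 < w\<close> by (simp add: b_def)
  qed
  finally have "eval2 p b b < eval2 p 0 b + 1"
    by (simp add: s)
  \<comment> \<open>The comparison point (0, 2w) is an integer point of \<open>R_y\<close>, where p
    is bounded directly.\<close>
  moreover have "eval2 p 0 b \<le> 1"
  proof -
    have "0 \<le> int (n + 1) * M"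
      using wM \<open>0 < w\<close> by simp
    then have "2 * w \<le> N"
      using N by linarith
    then have "real_of_int (2 * w) \<le> real_of_int N"
      by (simp only: of_int_le_iff)
    then have "(0, b) \<in> L_region w N"
      using \<open>0 < w\<close> by (simp add: L_region_def R_y_def b_def)
    then show ?thesis
      using bound[of 0 b] by (simp add: b_def)
  qed
  ultimately show ?thesis
    by (simp add: b_def)
qed

text \<open>The spacing is the least integer that \<open>corner_bound\<close> admits. The left side
  is at most w * 9000^n, and 2^(gamma w) is split into two equal factors: one absorbs w, because w
  is large compared to 1/gamma^2, the other absorbs 9000^n, because n is small compared to gamma
  w.\<close>

lemma step_size_fits:
  fixes w N :: int
  assumes "\<gamma> > 0" "0 < w" and "1 \<le> n"
    and n: "real n < min (1 / 4) (min (\<gamma> / 28) (\<gamma>\<^sup>2 / 32)) * real_of_int w"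
    and N: "2 powr (\<gamma> * real_of_int w) \<le> real_of_int N"
  shows "2 * w + int (n + 1) * (2 * w * 900 ^ n + 1) \<le> N"
proof -
  define W where "W = real_of_int w"
  have "W \<ge> 1"
    using \<open>0 < w\<close> by (simp add: W_def)
  have "min (1 / 4) (min (\<gamma> / 28) (\<gamma>\<^sup>2 / 32)) * W \<le> \<gamma> / 28 * W"
    using \<open>W \<ge> 1\<close> by (intro mult_right_mono) auto
  then have n1: "14 * real n \<le> \<gamma> * W / 2"
    using n by (simp add: W_def)
  have "min (1 / 4) (min (\<gamma> / 28) (\<gamma>\<^sup>2 / 32)) * W \<le> \<gamma>\<^sup>2 / 32 * W"
    using \<open>W \<ge> 1\<close> by (intro mult_right_mono) auto
  \<comment> \<open>Since n >= 1, an upper bound on n that is linear in W forces W to be large. This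
    is what lets the quadratic Taylor term of exp at gamma W / 4 dominate W.\<close>
  then have n2: "32 \<le> \<gamma>\<^sup>2 * W"
    using n \<open>1 \<le> n\<close> by (simp add: W_def)
  have "32 * W \<le> \<gamma>\<^sup>2 * W * W"
    using n2 \<open>W \<ge> 1\<close> by (intro mult_right_mono) auto
  then have "W \<le> (\<gamma> * W / 4)\<^sup>2 / 2"
    by (simp add: power2_eq_square algebra_simps)
  also have "\<dots> \<le> exp (\<gamma> * W / 4)"
  proof -
    have "0 \<le> \<gamma> * W / 4"
      using \<open>\<gamma> > 0\<close> \<open>W \<ge> 1\<close> by simp
    then show ?thesis
      using exp_lower_Taylor_quadratic[of "\<gamma> * W / 4"] by linarith
  qed
  also have "\<dots> \<le> 2 powr (\<gamma> * W / 2)"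
  proof -
    \<comment> \<open>In base 2 the exponent gamma W / 4 at most doubles, because ln 2 >= 1/2, that
      is, e <= 4.\<close>
    have "1 / 2 \<le> ln (2::real)"
      using exp_le by (subst ln_ge_iff) (auto intro: power2_le_imp_le simp flip: exp_double)
    then have "\<gamma> * W / 2 * (1 / 2) \<le> \<gamma> * W / 2 * ln 2"
      using \<open>\<gamma> > 0\<close> \<open>W \<ge> 1\<close> by (intro mult_left_mono) auto
    then show ?thesis
      by (simp add: powr_def)
  qed
  finally have W_le: "W \<le> 2 powr (\<gamma> * W / 2)" .
  have "(9000::real) ^ n \<le> (2 ^ 14) ^ n"
    by (intro power_mono) auto
  also have "\<dots> = 2 powr (14 * real n)"
    using powr_realpow[of 2 "14 * n"] by (simp add: power_mult)
  also have "\<dots> \<le> 2 powr (\<gamma> * W / 2)"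
    using n1 by simp
  finally have "W * 9000 ^ n \<le> 2 powr (\<gamma> * W / 2) * 2 powr (\<gamma> * W / 2)"
    using W_le \<open>W \<ge> 1\<close> by (intro mult_mono) auto
  also have "\<dots> = 2 powr (\<gamma> * W)"
    by (simp flip: powr_add add: mult.commute)
  also have "\<dots> \<le> real_of_int N"
    using N by (simp add: W_def)
  finally have "real_of_int (w * 9000 ^ n) \<le> real_of_int N"
    by (simp add: W_def)
  then have N': "w * 9000 ^ n \<le> N"
    by (simp only: of_int_le_iff)
  \<comment> \<open>The base 9000 is 900 * 2 * 5: the 2 absorbs n + 1 <= 2^n, and the 5 absorbs the
    constant 5 = 2 + 3 that collects the multiples of w.\<close>
  have pow1: "1 \<le> (900::int) ^ n" "1 \<le> (1800::int) ^ n"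
    by auto
  have "1 * 1 \<le> w * 900 ^ n"
    using \<open>0 < w\<close> pow1 by (intro mult_mono) auto
  then have "2 * w * 900 ^ n + 1 \<le> 3 * w * 900 ^ n"
    by linarith
  moreover have "n + 1 \<le> 2 ^ n"
    by (simp add: Suc_le_eq)
  then have "int (n + 1) \<le> 2 ^ n"
    by (metis of_nat_le_iff of_nat_numeral of_nat_power)
  ultimately have "int (n + 1) * (2 * w * 900 ^ n + 1) \<le> 2 ^ n * (3 * w * 900 ^ n)"
    using \<open>0 < w\<close> by (intro mult_mono) auto
  also have "\<dots> = 3 * w * (2 * 900) ^ n"
    unfolding power_mult_distrib by simp
  finally have "int (n + 1) * (2 * w * 900 ^ n + 1) \<le> 3 * w * 1800 ^ n"
    by simp
  moreover have "w * 1 \<le> w * 1800 ^ n"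
    using \<open>0 < w\<close> pow1 by (intro mult_left_mono) auto
  ultimately have "2 * w + int (n + 1) * (2 * w * 900 ^ n + 1) \<le> w * (5 * 1800 ^ n)"
    by simp
  also have "\<dots> \<le> w * (5 ^ n * 1800 ^ n)"
    using \<open>0 < w\<close> \<open>1 \<le> n\<close> self_le_power[of "5::int" n]
    by (intro mult_left_mono mult_right_mono) auto
  also have "\<dots> = w * 9000 ^ n"
    by (simp flip: power_mult_distrib)
  finally show ?thesis
    using N' by linarith
qed

theorem theorem3:
  fixes \<gamma> :: real
  assumes "\<gamma> > 0"
  shows "\<exists>c::real. c > 0 \<and>
    (\<forall>(w::int) (N::int) (p::real poly poly) (d::nat).
       0 < w \<longrightarrow> w < 2 * w \<longrightarrow> 2 * w \<le> N \<longrightarrow>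
       real_of_int N \<ge> 2 powr (\<gamma> * real_of_int w) \<longrightarrow>
       total_degree p = d \<longrightarrow>
       eval2 p (2 * real_of_int w) (2 * real_of_int w) \<ge> 2 \<longrightarrow>
       (\<forall>(x, y) \<in> L_region w N \<inter> (\<int> \<times> \<int>). 0 \<le> eval2 p x y \<and> eval2 p x y \<le> 1) \<longrightarrow>
       real d \<ge> c * real_of_int w)"
proof -
  \<comment> \<open>The 1/4 yields d <= w, so that [0, w] has room for d + 1 integer nodes; the two
    terms in gamma are those of \<open>step_size_fits\<close>.\<close>
  define c where "c = min (1 / 4) (min (\<gamma> / 28) (\<gamma>\<^sup>2 / 32))"
  have "c > 0"
    using assms by (simp add: c_def)
  have "c * real_of_int w \<le> real d"
    if w: "0 < w" "2 * w \<le> N" "2 powr (\<gamma> * real_of_int w) \<le> real_of_int N"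
      and d: "total_degree p = d"
      and corner: "2 \<le> eval2 p (2 * real_of_int w) (2 * real_of_int w)"
      and bound: "\<forall>(x, y) \<in> L_region w N \<inter> (\<int> \<times> \<int>). 0 \<le> eval2 p x y \<and> eval2 p x y \<le> 1"
    for w N :: int and p :: "real poly poly" and d :: nat
  proof (rule ccontr)
    assume "\<not> ?thesis"
    then have d_less: "real d < c * real_of_int w"
      by simp
    show False
    proof (cases "d = 0")
      \<comment> \<open>Degree 0 has no spacing w div d and is treated directly: the slice at y = 2w
        is constant, so p(0, 2w) = p(2w, 2w) >= 2, although (0, 2w) lies in
        \<open>R_y\<close>.\<close>
      case True
      obtain r where r: "degree r \<le> total_degree p"
          "\<And>x. eval2 p x (2 * real_of_int w) = poly r x"
        using slice_x_exists by metis
      obtain a where "r = [:a:]"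
        using r(1) d True by (auto elim: degree_eq_zeroE)
      then have "eval2 p 0 (2 * real_of_int w) \<ge> 2"
        using corner by (simp add: r(2))
      moreover have "2 * real_of_int w \<le> real_of_int N"
        using w(2) by linarith
      then have "(0, 2 * real_of_int w) \<in> L_region w N \<inter> (\<int> \<times> \<int>)"
        using w(1) by (simp add: L_region_def R_y_def)
      ultimately show False
        using bound by (smt (verit) case_prodD)
    next
      case False
      have "c * real_of_int w \<le> 1 / 4 * real_of_int w"
        using w(1) by (intro mult_right_mono) (auto simp: c_def)
      then have "int d \<le> w"
        using d_less w(1) by linarith
      moreover have "2 * w + int (d + 1) * (2 * w * 900 ^ d + 1) \<le> N"
        using assms w d_less False by (intro step_size_fits[of \<gamma>]) (auto simp: c_def)
      ultimately have "eval2 p (2 * real_of_int w) (2 * real_of_int w) < 2"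
        using w(1) d False bound by (intro corner_bound[of w p d "2 * w * 900 ^ d + 1" N]) auto
      with corner show False
        by simp
    qed
  qed
  with \<open>c > 0\<close> show ?thesis
    by blast
qed

end
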